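(* Let $q\ge1$ be real, let ${\sf m}=(m_1,\dots,m_\ell)$ be a tuple of positive integers with $m_1+\cdots+m_\ell=n$, and let $\overline{x}_1,\dots,\overline{x}_\ell$ be positive reals with $\overline{x}_1+\cdots+\overline{x}_\ell=1$. For $w\in W_{\sf m}$ define \[ \Psi(q,\overline{{\sf x}})_w=\frac{q^{-\mathrm{inv}(w)}\prod_{i=1}^\ell q^{-m_i+1}[m_i]_q!}{\prod_{k=1}^{n-1}\left(\overline{x}_1+\cdots+\overline{x}_\ell-q^{k-n-1}\kappa(w_1,\dots,w_{k-1};\overline{{\sf x}})\right)}\times\left(\prod_{\substack{1\le k\le n-1\\k\in\mathrm{LRM}(w)}}\kappa(w_k;\overline{{\sf x}})\prod_{\substack{1\le k\le n-1\\k\notin\mathrm{LRM}(w)}}\Big(\kappa(w_{p_k},\dots,w_k;\overline{{\sf x}})-q^{-1}\kappa(w_{p_k},\dots,w_{k-1};\overline{{\sf x}})\Big)\right). \] Then (1) $\Psi(q,\overline{{\sf x}})\cdot\mathcal{T}_{W_{\sf m}}(q,\overline{{\sf x}})=\left(\sum_{i=1}^\ell\overline{x}_i\right)\Psi(q,\overline{{\sf x}})$; (2) each factor of $\Psi(q,\overline{{\sf x}})_w$ is positive; (3) the entries of $\Psi(q,\overline{{\sf x}})$ sum to $1$.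
   Context: $W_{\sf m}$ is the set of words of length $n$ in the alphabet $\{1,\dots,\ell\}$ containing exactly $m_j$ copies of letter $j$. For $w\in W_{\sf m}$ and $1\le i\le n-1$, $ws_i$ denotes $w$ with positions $i,i+1$ swapped. On the real vector space with basis $W_{\sf m}$, Hecke generators act on the right by $w\cdot T_i=q\,ws_i$ if $w_{i+1}\le w_i$, and $w\cdot T_i=ws_i+(q-1)w$ if $w_{i+1}>w_i$. Let $[m]_q=1+q+\cdots+q^{m-1}$, $[m]_q!=[1]_q\cdots[m]_q$, and let $\mathcal{X}$ act by $w\cdot\mathcal{X}=\frac{\overline{x}_{w_1}}{q^{m_{w_1+1}+\cdots+m_\ell}[m_{w_1}]_q}w$. The $q$-Tsetlin library on words is $\mathcal{T}_{W_{\sf m}}(q,\overline{{\sf x}})=\sum_{i=1}^nT_{i-1}\cdots T_1\mathcal{X}$ acting on the right (apply $T_{i-1}$, then $T_{i-2}$, …, $T_1$, then $\mathcal{X}$; the $i=1$ term is $\mathcal{X}$); $\Psi$ is viewed as a row vector indexed by $W_{\sf m}$. For a weakly decreasing tuple ${\sf b}=(b_1,\dots,b_k)$ of letters, $\kappa({\sf b};\overline{{\sf x}})=\sum_{i=1}^k\frac{q^{i+m_1+\cdots+m_{b_i}-k-1}}{[m_{b_i}]_q}\overline{x}_{b_i}$; for an arbitrary tuple use its weakly decreasing rearrangement; the empty tuple gives $0$. A position $i$ is a left-to-right minimum of $w$ if $w_i\le w_j$ for all $j<i$; $\mathrm{LRM}(w)$ is the set of these. For $k\notin\mathrm{LRM}(w)$,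 $p_k$ is the smallest position $i<k$ with $w_i<w_k$. $\mathrm{inv}(w)=\#\{(i,j):i<j,\ w_i>w_j\}$.
   Formalization: The normalising factor q^{-m_i+1}[m_i]_q! is replaced by q^{-m_i(m_i-1)/2}[m_i]_q!, since with the printed factor claim (3) fails when q>1 and some m_i≥3 (for ℓ=1, m=(3) the only entry would be q); for m_i≤2 or q=1 the two agree. *)

theory Defs
  imports Complex_Main
begin

text \<open>
  Words are lists of letters from \<open>{1..l}\<close>; the tuples \<open>m\<close> and \<open>x\<close> are functions that matter only
  on \<open>{1..l}\<close>. Positions in words are counted from 1, whereas \<open>nth\<close> counts from 0.
\<close>

definition letter :: "nat list \<Rightarrow> nat \<Rightarrow> nat" where
  "letter w i = w ! (i - 1)"

definition subword :: "nat list \<Rightarrow> nat \<Rightarrow> nat \<Rightarrow> nat list" where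
  "subword w a b = map (letter w) [a..<Suc b]"

definition words :: "nat \<Rightarrow> nat \<Rightarrow> (nat \<Rightarrow> nat) \<Rightarrow> nat list set" where
  "words n l m = {w. length w = n \<and> set w \<subseteq> {1..l} \<and> (\<forall>j\<in>{1..l}. count_list w j = m j)}"

definition swap_at :: "nat list \<Rightarrow> nat \<Rightarrow> nat list" where
  "swap_at w i = w[i - 1 := letter w (i + 1), i := letter w i]"

definition q_int :: "real \<Rightarrow> nat \<Rightarrow> real" where
  "q_int q k = (\<Sum>i<k. q ^ i)"

definition q_fact :: "real \<Rightarrow> nat \<Rightarrow> real" where
  "q_fact q k = (\<Prod>i=1..k. q_int q i)"

text \<open>
  A vector of the space with basis \<open>W\<close> is represented by its coordinate function; only the
  values on \<open>W\<close> matter. Operators act on the right: \<open>extend W f v\<close> is \<open>v \<cdot> A\<close>, where \<open>A\<close> is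
  the linear operator with \<open>w \<cdot> A = f w\<close> for the basis vectors \<open>w \<in> W\<close>.
\<close>

definition basis_vec :: "nat list \<Rightarrow> nat list \<Rightarrow> real" where
  "basis_vec w u = (if u = w then 1 else 0)"

definition extend :: "nat list set \<Rightarrow> (nat list \<Rightarrow> nat list \<Rightarrow> real) \<Rightarrow>
    (nat list \<Rightarrow> real) \<Rightarrow> nat list \<Rightarrow> real" where
  "extend W f v u = (\<Sum>w\<in>W. v w * f w u)"

definition hecke_word :: "real \<Rightarrow> nat \<Rightarrow> nat list \<Rightarrow> nat list \<Rightarrow> real" where
  "hecke_word q i w u =
     (if letter w (i + 1) \<le> letter w i
      then q * basis_vec (swap_at w i) u
      else basis_vec (swap_at w i) u + (q - 1) * basis_vec w u)"

definition X_word :: "nat \<Rightarrow> (nat \<Rightarrow> nat) \<Rightarrow> real \<Rightarrow> (nat \<Rightarrow> real) \<Rightarrow>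
    nat list \<Rightarrow> nat list \<Rightarrow> real" where
  "X_word l m q x w u =
     x (letter w 1) / (q ^ (\<Sum>j=letter w 1 + 1..l. m j) * q_int q (m (letter w 1))) * basis_vec w u"

definition hecke :: "nat list set \<Rightarrow> real \<Rightarrow> nat \<Rightarrow> (nat list \<Rightarrow> real) \<Rightarrow> nat list \<Rightarrow> real" where
  "hecke W q i = extend W (hecke_word q i)"

text \<open>\<open>hecke_down W q k v\<close> is \<open>v \<cdot> T\<^sub>k T\<^bsub>k-1\<^esub> \<cdots> T\<^sub>1\<close>, with \<open>T\<^sub>k\<close> applied first.\<close>

primrec hecke_down :: "nat list set \<Rightarrow> real \<Rightarrow> nat \<Rightarrow> (nat list \<Rightarrow> real) \<Rightarrow> nat list \<Rightarrow> real" where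
  "hecke_down W q 0 v = v"
| "hecke_down W q (Suc k) v = hecke_down W q k (hecke W q (Suc k) v)"

definition tsetlin :: "nat \<Rightarrow> nat \<Rightarrow> (nat \<Rightarrow> nat) \<Rightarrow> real \<Rightarrow> (nat \<Rightarrow> real) \<Rightarrow>
    (nat list \<Rightarrow> real) \<Rightarrow> nat list \<Rightarrow> real" where
  "tsetlin n l m q x v u =
     (\<Sum>i=1..n. extend (words n l m) (X_word l m q x) (hecke_down (words n l m) q (i - 1) v) u)"

definition kappa_decr :: "(nat \<Rightarrow> nat) \<Rightarrow> real \<Rightarrow> (nat \<Rightarrow> real) \<Rightarrow> nat list \<Rightarrow> real" where
  "kappa_decr m q x b =
     (\<Sum>i=1..length b.
        q powi (int i + int (\<Sum>j=1..letter b i. m j) - int (length b) - 1)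
          / q_int q (m (letter b i)) * x (letter b i))"

definition kappa :: "(nat \<Rightarrow> nat) \<Rightarrow> real \<Rightarrow> (nat \<Rightarrow> real) \<Rightarrow> nat list \<Rightarrow> real" where
  "kappa m q x b = kappa_decr m q x (rev (sort b))"

definition LRM :: "nat list \<Rightarrow> nat set" where
  "LRM w = {i\<in>{1..length w}. \<forall>j\<in>{1..<i}. letter w i \<le> letter w j}"

definition first_smaller :: "nat list \<Rightarrow> nat \<Rightarrow> nat" where
  "first_smaller w k = (LEAST i. 1 \<le> i \<and> i < k \<and> letter w i < letter w k)"

definition inv_word :: "nat list \<Rightarrow> nat" where
  "inv_word w = card {(i, j). 1 \<le> i \<and> i < j \<and> j \<le> length w \<and> letter w i > letter w j}"

text \<open>
  In the normalising factor \<open>q\<^bsup>-k+1\<^esup>[k]\<^sub>q!\<close> the factorial has to be taken of all of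
  \<open>q\<^bsup>-k+1\<^esup>[k]\<^sub>q\<close>, i.e. the factor is \<open>\<Prod>r=1..k. q\<^bsup>-r+1\<^esup>[r]\<^sub>q\<close>, which is \<open>[k]\<^sub>q!\<close> times
  \<open>q\<close> to the power \<open>-(k choose 2)\<close>.
  With exponent \<open>-k+1\<close> the entries of \<open>Psi\<close> would not sum to 1 once some \<open>m j \<ge> 3\<close> and \<open>q > 1\<close>:
  for \<open>l = 1\<close>, \<open>m 1 = 3\<close>, \<open>x 1 = 1\<close>, the only entry would be \<open>q\<close>.
\<close>

definition norm_factor :: "real \<Rightarrow> nat \<Rightarrow> real" where
  "norm_factor q k = q powi (- int (k choose 2)) * q_fact q k"

definition denom_factor :: "nat \<Rightarrow> nat \<Rightarrow> (nat \<Rightarrow> nat) \<Rightarrow> real \<Rightarrow> (nat \<Rightarrow> real) \<Rightarrow>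
    nat list \<Rightarrow> nat \<Rightarrow> real" where
  "denom_factor n l m q x w k =
     (\<Sum>i=1..l. x i) - q powi (int k - int n - 1) * kappa m q x (subword w 1 (k - 1))"

definition ascent_factor :: "(nat \<Rightarrow> nat) \<Rightarrow> real \<Rightarrow> (nat \<Rightarrow> real) \<Rightarrow> nat list \<Rightarrow> nat \<Rightarrow> real" where
  "ascent_factor m q x w k =
     kappa m q x (subword w (first_smaller w k) k)
       - q powi (-1) * kappa m q x (subword w (first_smaller w k) (k - 1))"

definition Psi :: "nat \<Rightarrow> nat \<Rightarrow> (nat \<Rightarrow> nat) \<Rightarrow> real \<Rightarrow> (nat \<Rightarrow> real) \<Rightarrow> nat list \<Rightarrow> real" where
  "Psi n l m q x w =
     (q powi (- int (inv_word w)) * (\<Prod>i=1..l. norm_factor q (m i)))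
       / (\<Prod>k=1..n-1. denom_factor n l m q x w k)
     * ((\<Prod>k\<in>{1..n-1} \<inter> LRM w. kappa m q x [letter w k])
        * (\<Prod>k\<in>{1..n-1} - LRM w. ascent_factor m q x w k))"

end

theory Submission
  imports Defs "HOL-Library.Multiset"
begin

text \<open>
  Let \<open>weight a\<close> be the eigenvalue of \<open>X\<close> on words starting with \<open>a\<close>, and let the mass of a
  tuple \<open>p\<close> be \<open>\<Sum>a. weight a * q^(number of letters > a in p) * [number of a in p]\<close>, which is
  \<open>kappa p\<close> up to the power \<open>q^(n - length p)\<close>. Every factor in the numerator of \<open>Psi w\<close>, at a
  left-to-right minimum or not, is then \<open>q^(n - k)\<close> times the mass gained by reading the \<open>k\<close>-th
  letter, and the denominators are \<open>1 - mass\<close> of the prefixes. So \<open>Psi w\<close> is \<open>q^(- inv w)\<close> times a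
  constant times the probability of \<open>w\<close> in a weighted sampling without replacement; as a full
  word has mass 1, the last step contributes 1.

  The entries sum to 1 by induction on the number of remaining letters, because the gains, weighted
  by \<open>q\<close>-counts of the remaining letters, sum to \<open>1 - mass p\<close>. For stationarity, conjugation by
  \<open>q^inv\<close> turns \<open>T\<^sub>j \<cdots> T\<^sub>1\<close> at \<open>u\<close> into a procedure carrying one letter to the right through
  \<open>u\<close>. Truncating the sum of these procedures at the first \<open>j\<close> letters of \<open>u\<close> and multiplying
  by the eigenvalue of \<open>X\<close> gives exactly the probability of that prefix. This follows by induction
  on \<open>j\<close> from the formula for the gain of \<open>d\<close> after \<open>p @ [c]\<close>, which has the same shape as the
  Hecke relation.
\<close>

section \<open>q-integers and normalising factors\<close>

lemma sum_split_at:
  fixes f :: "nat \<Rightarrow> 'a :: comm_monoid_add"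
  assumes "c \<in> {1..<e}"
  shows "(\<Sum>a=1..<e. f a) = (\<Sum>a=1..<c. f a) + f c + (\<Sum>a=Suc c..<e. f a)"
  using assms sum.atLeastLessThan_concat[of 1 c e f] sum.atLeast_Suc_lessThan[of c e f]
  by (simp del: One_nat_def add: add.assoc)

lemma q_int_0 [simp]: "q_int q 0 = 0"
  by (simp add: q_int_def)

lemma q_int_Suc: "q_int q (Suc k) = q_int q k + q ^ k"
  by (simp add: q_int_def)

lemma q_int_add: "q_int q (i + j) = q_int q i + q ^ i * q_int q j"
  by (induction j) (auto simp: q_int_Suc algebra_simps power_add)

lemma q_int_mult: "(q - 1) * q_int q k = q ^ k - 1"
  by (induction k) (auto simp: q_int_Suc algebra_simps)

lemma q_int_nonneg: "q \<ge> 0 \<Longrightarrow> q_int q k \<ge> 0"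
  by (simp add: q_int_def sum_nonneg)

lemma q_int_pos: "q > 0 \<Longrightarrow> k > 0 \<Longrightarrow> q_int q k > 0"
  by (auto simp: q_int_def intro!: sum_pos)

text \<open>Because \<open>(q - 1) * q_int q (r a) = q ^ r a - 1\<close>, each summand becomes a
  difference of powers of \<open>q\<close> at consecutive tail sums of \<open>r\<close>, so the sum
  telescopes. This also covers q = 1.\<close>

lemma q_int_telescope:
  "(q - 1) * (\<Sum>a=Suc b..l. q ^ (\<Sum>j=Suc a..l. r j) * q_int q (r a)) = q ^ (\<Sum>j=Suc b..l. r j) - 1"
proof (induction l)
  case (Suc l)
  show ?case
  proof (cases "b \<le> l")
    case True
    have "(\<Sum>a=Suc b..l. q ^ (\<Sum>j=Suc a..Suc l. r j) * q_int q (r a))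
        = q ^ r (Suc l) * (\<Sum>a=Suc b..l. q ^ (\<Sum>j=Suc a..l. r j) * q_int q (r a))"
      unfolding sum_distrib_left by (rule sum.cong) (auto simp: power_add)
    then have "(q - 1) * (\<Sum>a=Suc b..Suc l. q ^ (\<Sum>j=Suc a..Suc l. r j) * q_int q (r a))
        = q ^ r (Suc l) * ((q - 1) * (\<Sum>a=Suc b..l. q ^ (\<Sum>j=Suc a..l. r j) * q_int q (r a)))
          + (q - 1) * q_int q (r (Suc l))"
      using True by (simp add: distrib_left mult.left_commute)
    also have "\<dots> = q ^ ((\<Sum>j=Suc b..l. r j) + r (Suc l)) - 1"
      unfolding Suc.IH q_int_mult power_add by (simp add: right_diff_distrib)
    finally show ?thesis
      using True by simp
  qed simp
qed simp

lemma norm_factor_0 [simp]: "norm_factor q 0 = 1"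
  by (simp add: norm_factor_def q_fact_def binomial_eq_0)

lemma norm_factor_Suc:
  assumes "q \<noteq> 0"
  shows "norm_factor q (Suc k) = q powi (- int k) * q_int q (Suc k) * norm_factor q k"
proof -
  have "Suc k choose 2 = k + (k choose 2)"
    by (simp add: numeral_2_eq_2)
  then show ?thesis
    using assms by (simp add: norm_factor_def q_fact_def power_int_diff power_int_minus field_simps power_add)
qed

lemma norm_factor_pos: "q > 0 \<Longrightarrow> norm_factor q k > 0"
  by (auto simp: norm_factor_def q_fact_def q_int_pos intro!: mult_pos_pos prod_pos)

section \<open>Letter counts, inversions and adjacent swaps\<close>

abbreviation larger :: "nat \<Rightarrow> nat list \<Rightarrow> nat" where
  "larger a p \<equiv> length (filter (\<lambda>b. a < b) p)"

abbreviation smaller :: "nat \<Rightarrow> nat list \<Rightarrow> nat" where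
  "smaller a p \<equiv> length (filter (\<lambda>b. b < a) p)"

lemma length_filter_eq_sum_count:
  fixes p :: "nat list"
  assumes "set p \<subseteq> {1..l}"
  shows "length (filter P p) = (\<Sum>j | j \<in> {1..l} \<and> P j. count_list p j)"
  using assms
proof (induction p)
  case (Cons a p)
  have "(\<Sum>j | j \<in> {1..l} \<and> P j. count_list (a # p) j)
      = (\<Sum>j | j \<in> {1..l} \<and> P j. count_list p j + (if j = a then 1 else 0))"
    by (rule sum.cong) auto
  also have "\<dots> = (\<Sum>j | j \<in> {1..l} \<and> P j. count_list p j) + (if P a then 1 else 0)"
    unfolding sum.distrib using Cons.prems by (subst sum.delta) auto
  finally show ?case
    using Cons by simp
qed simp

lemma larger_eq_sum_count:
  assumes "set p \<subseteq> {1..l}"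
  shows "larger a p = (\<Sum>j=Suc a..l. count_list p j)"
proof -
  have "{j. j \<in> {1..l} \<and> a < j} = {Suc a..l}" by auto
  then show ?thesis
    using length_filter_eq_sum_count[OF assms, of "\<lambda>b. a < b"] by simp
qed

lemma smaller_eq_sum_count:
  assumes "set p \<subseteq> {1..l}" "a \<le> l"
  shows "smaller a p = (\<Sum>j=1..<a. count_list p j)"
proof -
  have "{j. j \<in> {1..l} \<and> j < a} = {1..<a}" using assms(2) by auto
  then show ?thesis
    using length_filter_eq_sum_count[OF assms(1), of "\<lambda>b. b < a"] by simp
qed

lemma inv_word_Nil [simp]: "inv_word [] = 0"
proof -
  have "{(i, j). 1 \<le> i \<and> i < j \<and> j \<le> length ([] :: nat list) \<and> letter [] i > letter [] j} = {}"
    by auto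
  then show ?thesis unfolding inv_word_def by (simp only: card.empty)
qed

lemma inv_word_Cons: "inv_word (a # s) = smaller a s + inv_word s"
proof -
  let ?I = "\<lambda>w. {(i, j). 1 \<le> i \<and> i < j \<and> j \<le> length w \<and> letter w i > letter w j}"
  let ?A = "(\<lambda>j. (1 :: nat, Suc (Suc j))) ` {j. j < length s \<and> s ! j < a}"
  let ?B = "(\<lambda>(i, j). (Suc i, Suc j)) ` ?I s"
  have fin: "finite (?I s)"
    by (rule finite_subset[of _ "{..length s} \<times> {..length s}"]) auto
  have un: "?I (a # s) = ?A \<union> ?B"
  proof (intro set_eqI iffI)
    fix z assume "z \<in> ?I (a # s)"
    then obtain i j where ij: "z = (i, j)" "1 \<le> i" "i < j" "j \<le> Suc (length s)"
      "letter (a # s) i > letter (a # s) j" by auto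
    define i' j' where "i' = i - 1" and "j' = j - 2"
    then have s: "i = Suc i'" "j = Suc (Suc j')"
      using ij(2,3) by auto
    show "z \<in> ?A \<union> ?B"
    proof (cases i')
      case 0
      then show ?thesis using ij s by (auto simp: letter_def)
    next
      case (Suc k)
      then have "(i', Suc j') \<in> ?I s" using ij s by (auto simp: letter_def)
      then show ?thesis using ij(1) s by force
    qed
  next
    fix z assume "z \<in> ?A \<union> ?B"
    then show "z \<in> ?I (a # s)" by (auto simp: letter_def nth_Cons')
  qed
  have "card (?A \<union> ?B) = card ?A + card ?B"
    using fin by (intro card_Un_disjoint) auto
  moreover have "card ?A = smaller a s"
    by (subst card_image) (auto simp: inj_on_def length_filter_conv_card)
  moreover have "card ?B = inv_word s"
    unfolding inv_word_def by (subst card_image) (auto simp: inj_on_def)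
  ultimately show ?thesis
    unfolding inv_word_def[of "a # s"] un by (simp only:)
qed

lemma inv_word_swap:
  assumes "c < d"
  shows "inv_word (p @ d # c # r) = Suc (inv_word (p @ c # d # r))"
  using assms by (induction p) (auto simp: inv_word_Cons)

lemma subword_eq: "a \<ge> 1 \<Longrightarrow> b \<le> length w \<Longrightarrow> subword w a b = drop (a - 1) (take b w)"
  by (intro nth_equalityI) (auto simp: subword_def letter_def simp del: upt_Suc)

lemma swap_at_append [simp]: "swap_at (p @ c # d # r) (Suc (length p)) = p @ d # c # r"
  by (simp add: swap_at_def letter_def list_update_append nth_append)

lemma split_two:
  assumes "Suc k < length w"
  obtains p c d r where "w = p @ c # d # r" "length p = k"
proof
  show "w = take k w @ w ! k # w ! Suc k # drop (Suc (Suc k)) w"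
    using assms by (simp add: Cons_nth_drop_Suc)
  show "length (take k w) = k"
    using assms by simp
qed

section \<open>Words and coordinates of the Hecke operators\<close>

lemma words_cong_mset: "mset w = mset w' \<Longrightarrow> w \<in> words n l m \<longleftrightarrow> w' \<in> words n l m"
  unfolding words_def mem_Collect_eq by (metis count_mset mset_eq_length mset_eq_setD)

lemma finite_words: "finite (words n l m)"
  by (rule finite_subset[OF _ finite_lists_length_eq[of "{1..l}" n]]) (auto simp: words_def)

text \<open>Only \<open>u\<close> and its swap contribute to the coordinate at \<open>u\<close>. The
  coefficient of the swapped word is decided by the order of letters in that word, which is why
  \<open>q\<close> appears for \<open>c \<le> d\<close>.\<close>

lemma hecke_apply:
  assumes u: "p @ c # d # r \<in> words n l m"
  shows "hecke (words n l m) q (Suc (length p)) v (p @ c # d # r)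
    = (if c \<le> d then q else 1) * v (p @ d # c # r) + (if c < d then q - 1 else 0) * v (p @ c # d # r)"
proof -
  let ?W = "words n l m" and ?i = "Suc (length p)" and ?u = "p @ c # d # r" and ?u' = "p @ d # c # r"
  have u': "?u' \<in> ?W"
    using u by (subst words_cong_mset[of _ ?u]) auto
  have swap: "swap_at w ?i = ?u \<longleftrightarrow> w = ?u'" if "w \<in> ?W" for w
  proof -
    have "length w = length ?u" using that u by (auto simp: words_def)
    then obtain p' c' d' r' where w: "w = p' @ c' # d' # r'" and p': "length p' = length p"
      by (elim split_two[of "length p" w, rotated]) auto
    show ?thesis unfolding w using p' swap_at_append[of p' c' d' r'] by auto
  qed
  define \<alpha> where "\<alpha> w = (if letter w (?i + 1) \<le> letter w ?i then q else 1)" for w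
  define \<beta> where "\<beta> w = (if letter w (?i + 1) \<le> letter w ?i then 0 else q - 1)" for w
  \<comment> \<open>The two indicators are kept apart because \<open>?u\<close> and
    \<open>?u'\<close> are the same word when \<open>c = d\<close>.\<close>
  have ind: "v w * (\<alpha> w * (if P then 1 else 0) + \<beta> w * (if Q then 1 else 0))
      = (if P then \<alpha> w * v w else 0) + (if Q then \<beta> w * v w else 0)" for w P Q
    by (cases P; cases Q) (simp_all add: algebra_simps)
  have "hecke ?W q ?i v ?u
      = (\<Sum>w\<in>?W. (if w = ?u' then \<alpha> w * v w else 0) + (if w = ?u then \<beta> w * v w else 0))"
    unfolding hecke_def extend_def
  proof (rule sum.cong)
    fix w assume "w \<in> ?W"
    then have s: "basis_vec (swap_at w ?i) ?u = (if w = ?u' then 1 else 0)"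
      using swap[of w] unfolding basis_vec_def by metis
    have t: "basis_vec w ?u = (if w = ?u then 1 else 0)"
      unfolding basis_vec_def by metis
    have "hecke_word q ?i w ?u = \<alpha> w * basis_vec (swap_at w ?i) ?u + \<beta> w * basis_vec w ?u"
      unfolding hecke_word_def \<alpha>_def \<beta>_def by simp
    then show "v w * hecke_word q ?i w ?u
        = (if w = ?u' then \<alpha> w * v w else 0) + (if w = ?u then \<beta> w * v w else 0)"
      unfolding s t using ind[of w] by (simp only:)
  qed simp
  also have "\<dots> = \<alpha> ?u' * v ?u' + \<beta> ?u * v ?u"
    using u u' by (simp add: sum.distrib sum.delta finite_words)
  finally show ?thesis
    by (simp add: \<alpha>_def \<beta>_def letter_def nth_append)
qed

lemma length_filter_cong_mset: "mset p = mset p' \<Longrightarrow> length (filter P p) = length (filter P p')"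
  by (metis mset_filter size_mset)

lemma count_list_cong_mset: "mset p = mset p' \<Longrightarrow> count_list p a = count_list p' a"
  by (metis count_mset)

lemma mset_replace_prefix:
  assumes "mset (p @ [c]) = mset (take i u)"
  shows "mset (p @ c # drop i u) = mset u"
proof -
  have "mset (p @ c # drop i u) = mset (p @ [c]) + mset (drop i u)"
    by simp
  also have "\<dots> = mset (take i u @ drop i u)"
    unfolding assms by (simp only: mset_append)
  finally show ?thesis
    by (simp only: append_take_drop_id)
qed

lemma letter_in_alphabet:
  assumes "w \<in> words n l m" "k \<in> {1..n}"
  shows "letter w k \<in> {1..l}"
proof -
  have "w ! (k - 1) \<in> set w"
    using assms by (intro nth_mem) (auto simp: words_def)
  then show ?thesis
    using assms by (auto simp: words_def letter_def)
qed

section \<open>Weight, mass and gain of a prefix\<close>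

locale tsetlin_parameters =
  fixes n l :: nat and m :: "nat \<Rightarrow> nat" and q :: real and x :: "nat \<Rightarrow> real"
  assumes q_ge_1: "q \<ge> 1"
    and m_pos: "\<And>j. j \<in> {1..l} \<Longrightarrow> m j > 0"
    and sum_m: "(\<Sum>j=1..l. m j) = n"
    and x_pos: "\<And>j. j \<in> {1..l} \<Longrightarrow> x j > 0"
    and sum_x: "(\<Sum>j=1..l. x j) = 1"
begin

lemma q_pos: "q > 0"
  using q_ge_1 by simp

definition weight :: "nat \<Rightarrow> real" where
  "weight a = x a / (q ^ (\<Sum>j=Suc a..l. m j) * q_int q (m a))"

definition mass :: "nat list \<Rightarrow> real" where
  "mass p = (\<Sum>a=1..l. weight a * q ^ larger a p * q_int q (count_list p a))"

text \<open>An explicit form of the mass increase, chosen so that positivity is visible: for q >= 1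
  and letters of the alphabet every summand is nonnegative.\<close>

definition gain :: "nat list \<Rightarrow> nat \<Rightarrow> real" where
  "gain p d = (\<Sum>a=1..<d. (q - 1) * (weight a * q ^ larger a p * q_int q (count_list p a)))
    + weight d * q ^ (larger d p + count_list p d)"

lemma weight_pos: "a \<in> {1..l} \<Longrightarrow> weight a > 0"
  unfolding weight_def using x_pos m_pos q_pos by (auto intro!: divide_pos_pos mult_pos_pos q_int_pos)

lemma mass_Nil [simp]: "mass [] = 0"
  by (simp add: mass_def)

lemma gain_Nil [simp]: "gain [] a = weight a"
  by (simp add: gain_def)

lemma gain_pos:
  assumes "d \<in> {1..l}"
  shows "gain p d > 0"
proof -
  have "(q - 1) * (weight a * q ^ larger a p * q_int q (count_list p a)) \<ge> 0" if "a \<in> {1..<d}" for a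
    using that assms weight_pos[of a] q_ge_1 by (intro mult_nonneg_nonneg q_int_nonneg) auto
  moreover have "weight d * q ^ (larger d p + count_list p d) > 0"
    using weight_pos[OF assms] q_pos by simp
  ultimately show ?thesis
    unfolding gain_def by (intro add_nonneg_pos sum_nonneg) auto
qed

lemma mass_cong_mset: "mset p = mset p' \<Longrightarrow> mass p = mass p'"
  unfolding mass_def by (simp only: length_filter_cong_mset[of p p'] count_list_cong_mset[of p p'])

lemma gain_cong_mset: "mset p = mset p' \<Longrightarrow> gain p = gain p'"
  unfolding gain_def by (simp only: length_filter_cong_mset[of p p'] count_list_cong_mset[of p p'])

text \<open>Reading \<open>c\<close> multiplies the terms of the letters below \<open>c\<close> by
  \<open>q\<close>, leaves those above \<open>c\<close> alone, and adds one power of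
  \<open>q\<close> to the q-count of \<open>c\<close>.\<close>

lemma mass_snoc:
  assumes "c \<in> {1..l}"
  shows "mass (p @ [c]) = mass p + gain p c"
proof -
  let ?t = "\<lambda>p a. weight a * q ^ larger a p * q_int q (count_list p a)"
  have c: "c \<in> {1..<Suc l}" using assms by auto
  have "(\<Sum>a=1..<c. ?t (p @ [c]) a) = (\<Sum>a=1..<c. q * ?t p a)"
    by (rule sum.cong) auto
  moreover have "(\<Sum>a=Suc c..<Suc l. ?t (p @ [c]) a) = (\<Sum>a=Suc c..<Suc l. ?t p a)"
    by (rule sum.cong) auto
  moreover have "?t (p @ [c]) c = ?t p c + weight c * q ^ (larger c p + count_list p c)"
    by (simp add: q_int_Suc power_add algebra_simps)
  moreover have "gain p c = (\<Sum>a=1..<c. q * ?t p a) - (\<Sum>a=1..<c. ?t p a)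
      + weight c * q ^ (larger c p + count_list p c)"
    unfolding gain_def by (simp add: sum_distrib_left sum_subtractf[symmetric] algebra_simps)
  ultimately show ?thesis
    unfolding mass_def atLeastLessThanSuc_atLeastAtMost[symmetric] sum_split_at[OF c] by simp
qed

text \<open>If \<open>d \<le> c\<close>, every exponent in \<open>gain p d\<close> rises by one.
  Otherwise only the terms of letters up to \<open>c\<close> change, and their total change is
  \<open>(q - 1) * gain p c\<close>. The two cases mirror those of the Hecke relation.\<close>

lemma gain_snoc:
  assumes "c \<ge> 1"
  shows "gain (p @ [c]) d = (if d \<le> c then q * gain p d else gain p d + (q - 1) * gain p c)"
proof -
  let ?t = "\<lambda>p a. weight a * q ^ larger a p * q_int q (count_list p a)"
  let ?g = "\<lambda>p a. (q - 1) * ?t p a"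
  have low: "(\<Sum>a=1..<e. ?g (p @ [c]) a) = q * (\<Sum>a=1..<e. ?g p a)" if "e \<le> c" for e
    unfolding sum_distrib_left by (rule sum.cong) (use that in auto)
  show ?thesis
  proof (cases "d \<le> c")
    case True
    then show ?thesis
      unfolding gain_def low[OF True] by (auto simp: algebra_simps power_add)
  next
    case False
    then obtain k where d: "d = Suc k" by (cases d) auto
    then have c: "c \<in> {1..<Suc k}" using False assms by auto
    have "(\<Sum>a=Suc c..<Suc k. ?g (p @ [c]) a) = (\<Sum>a=Suc c..<Suc k. ?g p a)"
      by (rule sum.cong) auto
    moreover have "?t (p @ [c]) c = ?t p c + weight c * q ^ (larger c p + count_list p c)"
      by (simp add: q_int_Suc power_add algebra_simps)
    ultimately show ?thesis
      using False low[of c] unfolding gain_def d sum_split_at[OF c]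
      by (simp add: algebra_simps)
  qed
qed

text \<open>With \<open>r\<close> counting the remaining letters, exchanging the double sum lets
  each letter \<open>b\<close> collect its tail by \<open>q_int_telescope\<close>. What
  \<open>b\<close> then contributes is \<open>x b\<close> minus its term in \<open>mass p\<close>,
  and the \<open>x b\<close> add up to 1.\<close>

lemma weighted_gain_sum:
  assumes p: "set p \<subseteq> {1..l}" and r: "\<And>j. j \<in> {1..l} \<Longrightarrow> count_list p j + r j = m j"
  shows "(\<Sum>a=1..l. q ^ (\<Sum>j=Suc a..l. r j) * q_int q (r a) * gain p a) = 1 - mass p"
proof -
  define R where "R a = q ^ (\<Sum>j=Suc a..l. r j)" for a
  define t where "t a = weight a * q ^ larger a p * q_int q (count_list p a)" for a
  have triangle: "(\<Sum>a=1..l. \<Sum>b=1..<a. f a b) = (\<Sum>b=1..l. \<Sum>a=Suc b..l. f a b)"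
    for f :: "nat \<Rightarrow> nat \<Rightarrow> real"
    by (simp add: sum.Sigma)
      (rule sum.reindex_bij_witness[of _ "\<lambda>(a, b). (b, a)" "\<lambda>(a, b). (b, a)"], auto)
  have "(\<Sum>a=1..l. R a * q_int q (r a) * gain p a)
      = (\<Sum>a=1..l. \<Sum>b=1..<a. R a * q_int q (r a) * ((q - 1) * t b))
        + (\<Sum>a=1..l. R a * q_int q (r a) * (weight a * q ^ (larger a p + count_list p a)))"
    unfolding gain_def t_def by (simp only: distrib_left sum.distrib sum_distrib_left)
  also have "(\<Sum>a=1..l. \<Sum>b=1..<a. R a * q_int q (r a) * ((q - 1) * t b))
      = (\<Sum>b=1..l. \<Sum>a=Suc b..l. R a * q_int q (r a) * ((q - 1) * t b))"
    by (rule triangle)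
  also have "\<dots> = (\<Sum>b=1..l. (R b - 1) * t b)"
  proof (rule sum.cong)
    fix b
    have "(\<Sum>a=Suc b..l. R a * q_int q (r a) * ((q - 1) * t b))
        = ((q - 1) * (\<Sum>a=Suc b..l. R a * q_int q (r a))) * t b"
      by (simp add: sum_distrib_left sum_distrib_right mult_ac)
    then show "(\<Sum>a=Suc b..l. R a * q_int q (r a) * ((q - 1) * t b)) = (R b - 1) * t b"
      unfolding R_def q_int_telescope .
  qed simp
  finally have "(\<Sum>a=1..l. R a * q_int q (r a) * gain p a)
      = (\<Sum>b=1..l. (R b - 1) * t b + R b * q_int q (r b) * (weight b * q ^ (larger b p + count_list p b)))"
    by (simp only: sum.distrib)
  also have "\<dots> = (\<Sum>b=1..l. x b - t b)"
  proof (rule sum.cong)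
    fix b assume b: "b \<in> {1..l}"
    have "(\<Sum>j=Suc b..l. m j) = larger b p + (\<Sum>j=Suc b..l. r j)"
      unfolding larger_eq_sum_count[OF p] sum.distrib[symmetric] using r by (intro sum.cong) auto
    then have m: "q ^ (\<Sum>j=Suc b..l. m j) = q ^ larger b p * R b"
      by (simp add: R_def power_add)
    have "q ^ (\<Sum>j=Suc b..l. m j) * q_int q (m b) \<noteq> 0"
      using q_pos q_int_pos[OF q_pos m_pos[OF b]] by auto
    \<comment> \<open>The q-count of all copies of \<open>b\<close> splits into the copies already
      read and those remaining, by \<open>q_int_add\<close>.\<close>
    then have "x b = weight b * (q ^ (\<Sum>j=Suc b..l. m j) * q_int q (m b))"
      by (simp add: weight_def)
    also have "\<dots> = weight b * q ^ larger b p * R b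
        * (q_int q (count_list p b) + q ^ count_list p b * q_int q (r b))"
      unfolding m r[OF b, symmetric] q_int_add by simp
    finally show "(R b - 1) * t b + R b * q_int q (r b) * (weight b * q ^ (larger b p + count_list p b))
        = x b - t b"
      unfolding t_def by (simp add: power_add algebra_simps)
  qed simp
  also have "\<dots> = 1 - mass p"
    unfolding mass_def t_def sum_subtractf sum_x ..
  finally show ?thesis
    unfolding R_def .
qed

text \<open>By \<open>weighted_gain_sum\<close> the missing mass is a sum of nonnegative terms, and
  the term of a letter not yet used up is positive.\<close>

lemma mass_less_1:
  assumes p: "set p \<subseteq> {1..l}" and le: "\<And>j. j \<in> {1..l} \<Longrightarrow> count_list p j \<le> m j" and "length p < n"
  shows "mass p < 1"
proof -
  define r where "r j = m j - count_list p j" for j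
  have "(\<Sum>j=1..l. count_list p j) \<noteq> (\<Sum>j=1..l. m j)"
    using length_filter_eq_sum_count[OF p, of "\<lambda>_. True"] sum_m assms(3)
    unfolding Collect_mem_eq simp_thms filter_True by simp
  then have "\<exists>c\<in>{1..l}. count_list p c \<noteq> m c"
    by (rule contrapos_np) (auto intro: sum.cong)
  then obtain c where c: "c \<in> {1..l}" "count_list p c \<noteq> m c"
    by blast
  have pos: "q ^ (\<Sum>j=Suc a..l. r j) * q_int q (r a) * gain p a \<ge> 0" if "a \<in> {1..l}" for a
    using gain_pos[OF that, of p] q_pos by (simp add: q_int_nonneg)
  have "r c > 0"
    using c le[of c] by (simp add: r_def)
  then have "q ^ (\<Sum>j=Suc c..l. r j) * q_int q (r c) * gain p c > 0"
    using gain_pos[OF c(1), of p] q_pos by (simp add: q_int_pos)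
  then have "(\<Sum>a=1..l. q ^ (\<Sum>j=Suc a..l. r j) * q_int q (r a) * gain p a) > 0"
    using pos c(1) by (intro sum_pos2[where i = c]) auto
  then show ?thesis
    using weighted_gain_sum[OF p, of r] le by (simp add: r_def)
qed

text \<open>No letters remain, so the weighted sum of gains with \<open>r = 0\<close>
  vanishes.\<close>

lemma mass_word:
  assumes "w \<in> words n l m"
  shows "mass w = 1"
proof -
  have "(\<Sum>a=1..l. q ^ (\<Sum>j=Suc a..l. 0) * q_int q 0 * gain w a) = 1 - mass w"
    using assms by (intro weighted_gain_sum) (auto simp: words_def)
  then show ?thesis
    by simp
qed

end

section \<open>Summing path weights over words\<close>

lemma words_Suc:
  "words (Suc N) l r = (\<Union>a\<in>{a \<in> {1..l}. r a > 0}. (#) a ` words N l (r(a := r a - 1)))"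
  (is "?L = ?R")
proof (intro set_eqI iffI)
  fix w assume w: "w \<in> ?L"
  then obtain a s where as: "w = a # s" by (cases w) (auto simp: words_def)
  have a: "a \<in> {1..l}" and cnt: "\<And>j. j \<in> {1..l} \<Longrightarrow> count_list (a # s) j = r j"
    using w as by (auto simp: words_def)
  have "s \<in> words N l (r(a := r a - 1))"
    using w as cnt[OF a] by (auto simp: words_def)
  moreover have "r a > 0"
    using cnt[OF a] by simp
  ultimately show "w \<in> ?R"
    using a as by blast
next
  fix w assume "w \<in> ?R"
  then obtain a s where "w = a # s" "a \<in> {1..l}" "r a > 0" "s \<in> words N l (r(a := r a - 1))"
    by blast
  then show "w \<in> ?L"
    by (auto simp: words_def)
qed

lemma sum_words_Suc:
  "(\<Sum>w\<in>words (Suc N) l r. f w)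
    = (\<Sum>a | a \<in> {1..l} \<and> r a > 0. \<Sum>s\<in>words N l (r(a := r a - 1)). f (a # s))"
proof -
  have "(\<Sum>w\<in>words (Suc N) l r. f w)
      = (\<Sum>a | a \<in> {1..l} \<and> r a > 0. \<Sum>w\<in>(#) a ` words N l (r(a := r a - 1)). f w)"
    unfolding words_Suc by (rule sum.UNION_disjoint) (auto simp: finite_words)
  then show ?thesis
    by (simp add: sum.reindex)
qed

lemma prod_norm_factor_remove:
  fixes l :: nat
  assumes "q \<noteq> 0" and a: "a \<in> {1..l}" "r a > 0"
  shows "(\<Prod>i=1..l. norm_factor q (r i))
    = q powi (- int (r a - 1)) * q_int q (r a) * (\<Prod>i=1..l. norm_factor q ((r(a := r a - 1)) i))"
proof -
  have "(\<Prod>i=1..l. norm_factor q ((r(a := r a - 1)) i))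
      = norm_factor q (r a - 1) * (\<Prod>i\<in>{1..l} - {a}. norm_factor q (r i))"
    unfolding prod.remove[OF finite_atLeastAtMost a(1)] by (rule arg_cong2[of _ _ _ _ "(*)"]) (auto intro: prod.cong)
  moreover have "norm_factor q (r a) = q powi (- int (r a - 1)) * q_int q (r a) * norm_factor q (r a - 1)"
    using norm_factor_Suc[OF assms(1), of "r a - 1"] a(2) by simp
  ultimately show ?thesis
    unfolding prod.remove[OF finite_atLeastAtMost a(1), of "\<lambda>i. norm_factor q (r i)"] by (simp only: mult.assoc)
qed

context tsetlin_parameters
begin

text \<open>The prefix already read is an argument, so that continuations can be summed by
  induction.\<close>

primrec path_weight :: "nat list \<Rightarrow> nat list \<Rightarrow> real" where
  "path_weight p [] = 1"
| "path_weight p (a # s) = gain p a / (1 - mass p) * path_weight (p @ [a]) s"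

lemma path_weight_append: "path_weight p (s @ t) = path_weight p s * path_weight (p @ s) t"
  by (induction s arbitrary: p) auto

text \<open>Induction on the number of remaining letters, splitting off the first one. After
  collecting powers of \<open>q\<close>, the choice of \<open>a\<close> carries exactly the
  coefficient of \<open>weighted_gain_sum\<close>, whose value \<open>1 - mass p\<close> cancels the
  denominator.\<close>

lemma sum_path_weight:
  assumes "set p \<subseteq> {1..l}" "\<And>j. j \<in> {1..l} \<Longrightarrow> count_list p j + r j = m j" "(\<Sum>j=1..l. r j) = N"
  shows "(\<Sum>s\<in>words N l r. q powi (- int (inv_word s)) * path_weight p s)
    = q powi (- int (N choose 2)) / (\<Prod>i=1..l. norm_factor q (r i))"
  using assms
proof (induction N arbitrary: p r)
  case 0
  then have r: "\<And>j. j \<in> {1..l} \<Longrightarrow> r j = 0"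
    by simp
  then have "words 0 l r = {[]}"
    by (auto simp: words_def)
  moreover have "(\<Prod>i=1..l. norm_factor q (r i)) = 1"
    using r by (intro prod.neutral) auto
  ultimately show ?case
    by (simp add: binomial_eq_0)
next
  case (Suc N)
  have q0: "q \<noteq> 0" using q_pos by simp
  let ?P = "\<Prod>i=1..l. norm_factor q (r i)"
  let ?K = "q powi (- int (Suc N choose 2)) / ?P / (1 - mass p)"
  have len: "length p + Suc N = n"
  proof -
    have "length p = (\<Sum>j=1..l. count_list p j)"
      using length_filter_eq_sum_count[OF Suc.prems(1), of "\<lambda>_. True"]
      unfolding Collect_mem_eq simp_thms filter_True by simp
    then have "length p + Suc N = (\<Sum>j=1..l. count_list p j + r j)"
      using Suc.prems(3) by (simp add: sum.distrib)
    also have "\<dots> = n"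
      unfolding sum_m[symmetric] using Suc.prems(2) by (intro sum.cong) auto
    finally show ?thesis .
  qed
  have le: "count_list p j \<le> m j" if "j \<in> {1..l}" for j
    using Suc.prems(2)[OF that] by linarith
  have mass: "mass p < 1"
    using mass_less_1[OF Suc.prems(1) le] len by simp
  have first: "(\<Sum>s\<in>words N l (r(a := r a - 1)). q powi (- int (inv_word (a # s))) * path_weight p (a # s))
      = ?K * (q ^ (\<Sum>j=Suc a..l. r j) * q_int q (r a) * gain p a)" if a: "a \<in> {1..l}" "r a > 0" for a
  proof -
    let ?r = "r(a := r a - 1)"
    let ?b = "\<Sum>j=1..<a. r j"
    have split: "?b + r a + (\<Sum>j=Suc a..l. r j) = Suc N"
    proof -
      have "a \<in> {1..<Suc l}" using a by auto
      then have "(\<Sum>j=1..<Suc l. r j) = ?b + r a + (\<Sum>j=Suc a..<Suc l. r j)"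
        by (rule sum_split_at)
      then show ?thesis
        using Suc.prems(3) by (simp only: atLeastLessThanSuc_atLeastAtMost)
    qed
    \<comment> \<open>The inversions made by the first letter depend only on the multiset of the
      rest, so they factor out of the sum over \<open>s\<close>.\<close>
    have sm: "smaller a s = ?b" if "s \<in> words N l ?r" for s
    proof -
      have "smaller a s = (\<Sum>j=1..<a. count_list s j)"
        using that a by (intro smaller_eq_sum_count[of _ l]) (auto simp: words_def)
      also have "\<dots> = ?b"
        using that a by (intro sum.cong) (auto simp: words_def)
      finally show ?thesis .
    qed
    have sum_r: "(\<Sum>j=1..l. ?r j) = N"
    proof -
      have "(\<Sum>j\<in>{1..l} - {a}. ?r j) = (\<Sum>j\<in>{1..l} - {a}. r j)"
        by (rule sum.cong) auto
      then have "(\<Sum>j=1..l. r j) = Suc (\<Sum>j=1..l. ?r j)"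
        using a sum.remove[OF finite_atLeastAtMost a(1), of r] sum.remove[OF finite_atLeastAtMost a(1), of ?r]
        by simp
      then show ?thesis using Suc.prems(3) by simp
    qed
    have IH: "(\<Sum>s\<in>words N l ?r. q powi (- int (inv_word s)) * path_weight (p @ [a]) s)
        = q powi (- int (N choose 2)) / (\<Prod>i=1..l. norm_factor q (?r i))"
    proof (rule Suc.IH[OF _ _ sum_r])
      show "set (p @ [a]) \<subseteq> {1..l}"
        using Suc.prems(1) a by auto
      show "count_list (p @ [a]) j + ?r j = m j" if "j \<in> {1..l}" for j
        using Suc.prems(2)[OF that] a by auto
    qed
    have "(\<Sum>s\<in>words N l ?r. q powi (- int (inv_word (a # s))) * path_weight p (a # s))
        = (\<Sum>s\<in>words N l ?r. q powi (- int ?b) * (gain p a / (1 - mass p))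
            * (q powi (- int (inv_word s)) * path_weight (p @ [a]) s))"
    proof (rule sum.cong)
      fix s assume s: "s \<in> words N l ?r"
      have "q powi (- int (inv_word (a # s))) = q powi (- int ?b) * q powi (- int (inv_word s))"
        unfolding inv_word_Cons sm[OF s] using q0
        by (simp only: of_nat_add minus_add_distrib power_int_add simp_thms)
      then show "q powi (- int (inv_word (a # s))) * path_weight p (a # s)
          = q powi (- int ?b) * (gain p a / (1 - mass p))
            * (q powi (- int (inv_word s)) * path_weight (p @ [a]) s)"
        by simp
    qed simp
    also have "\<dots> = q powi (- int ?b) * (gain p a / (1 - mass p))
        * (q powi (- int (N choose 2)) / (\<Prod>i=1..l. norm_factor q (?r i)))"
      unfolding sum_distrib_left[symmetric] IH ..
    also have "1 / (\<Prod>i=1..l. norm_factor q (?r i)) = q powi (- int (r a - 1)) * q_int q (r a) / ?P"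
    proof -
      have "q powi (- int (r a - 1)) * q_int q (r a) > 0"
        using a q_pos by (intro mult_pos_pos q_int_pos) auto
      moreover have "1 / P = c / (c * P)" if "c > 0" for c P :: real
        using that by simp
      ultimately show ?thesis
        unfolding prod_norm_factor_remove[of q a l r, OF q0 a] by blast
    qed
    then have "q powi (- int (N choose 2)) / (\<Prod>i=1..l. norm_factor q (?r i))
        = q powi (- int (N choose 2)) * (q powi (- int (r a - 1)) * q_int q (r a) / ?P)"
      by (metis mult.right_neutral times_divide_eq_right)
    also have "q powi (- int ?b) * (gain p a / (1 - mass p))
        * (q powi (- int (N choose 2)) * (q powi (- int (r a - 1)) * q_int q (r a) / ?P))
      = (q powi (- int ?b) * q powi (- int (N choose 2)) * q powi (- int (r a - 1)))
          * (q_int q (r a) * gain p a / ?P / (1 - mass p))"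
      by (simp add: mult_ac)
    \<comment> \<open>Since the remaining letters below, equal to and above \<open>a\<close> number
      \<open>Suc N\<close>, the exponent \<open>- ?b - (r a - 1)\<close> is the number above
      \<open>a\<close> minus \<open>N\<close>.\<close>
    also have "q powi (- int ?b) * q powi (- int (N choose 2)) * q powi (- int (r a - 1))
        = q powi (- int (Suc N choose 2)) * q ^ (\<Sum>j=Suc a..l. r j)"
    proof -
      have "Suc N choose 2 = N + (N choose 2)"
        by (simp add: numeral_2_eq_2)
      then have "- int ?b + - int (N choose 2) + - int (r a - 1)
          = - int (Suc N choose 2) + int (\<Sum>j=Suc a..l. r j)"
        using split a(2) by linarith
      then show ?thesis
        using q0 by (metis power_int_add power_int_of_nat)
    qed
    also have "q powi (- int (Suc N choose 2)) * q ^ (\<Sum>j=Suc a..l. r j)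
          * (q_int q (r a) * gain p a / ?P / (1 - mass p))
        = ?K * (q ^ (\<Sum>j=Suc a..l. r j) * q_int q (r a) * gain p a)"
      by (simp only: mult_ac times_divide_eq_left times_divide_eq_right)
    finally show ?thesis .
  qed
  have "(\<Sum>s\<in>words (Suc N) l r. q powi (- int (inv_word s)) * path_weight p s)
      = (\<Sum>a | a \<in> {1..l} \<and> r a > 0. ?K * (q ^ (\<Sum>j=Suc a..l. r j) * q_int q (r a) * gain p a))"
    unfolding sum_words_Suc by (rule sum.cong) (use first in auto)
  \<comment> \<open>Letters with \<open>r a = 0\<close> can be included, as
    \<open>q_int q 0 = 0\<close>.\<close>
  also have "\<dots> = (\<Sum>a=1..l. ?K * (q ^ (\<Sum>j=Suc a..l. r j) * q_int q (r a) * gain p a))"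
    by (rule sum.mono_neutral_left) auto
  also have "\<dots> = ?K * (1 - mass p)"
    unfolding sum_distrib_left[symmetric] using weighted_gain_sum[of p r] Suc.prems by simp
  finally show ?case
    using mass by simp
qed


section \<open>Carrying a letter through a word\<close>

text \<open>
  \<open>f p c\<close> stands for \<open>q^inv w * v w\<close> at the word \<open>w = p @ c # drop (j + 1) u\<close> with \<open>length p = j\<close>.
  Then \<open>carry u j f\<close> is \<open>q^inv u\<close> times the \<open>u\<close>-coordinate of \<open>v \<cdot> T\<^sub>j \<cdots> T\<^sub>1\<close>: \<open>c\<close> is the letter
  being carried, and \<open>p\<close> are the letters it has passed.
\<close>

primrec carry :: "nat list \<Rightarrow> nat \<Rightarrow> (nat list \<Rightarrow> nat \<Rightarrow> real) \<Rightarrow> real" where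
  "carry u 0 f = f [] (u ! 0)"
| "carry u (Suc j) f = carry u j (\<lambda>p c. if u ! Suc j \<le> c then q * f (p @ [u ! Suc j]) c
      else f (p @ [u ! Suc j]) c + (q - 1) * f (p @ [c]) (u ! Suc j))"

text \<open>The recursion evaluates its function argument only at rearrangements of the first
  \<open>Suc j\<close> letters of \<open>u\<close>, so agreement there suffices.\<close>

lemma carry_cong:
  assumes "j < length u" "\<And>p c. mset (p @ [c]) = mset (take (Suc j) u) \<Longrightarrow> f p c = g p c"
  shows "carry u j f = carry u j g"
  using assms
proof (induction j arbitrary: f g)
  case 0
  then show ?case by (simp add: take_Suc_conv_app_nth)
next
  case (Suc j)
  have "take (Suc (Suc j)) u = take (Suc j) u @ [u ! Suc j]"
    using Suc.prems(1) by (simp add: take_Suc_conv_app_nth)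
  then have eq: "f (p @ [u ! Suc j]) c = g (p @ [u ! Suc j]) c" "f (p @ [c]) (u ! Suc j) = g (p @ [c]) (u ! Suc j)"
    if "mset (p @ [c]) = mset (take (Suc j) u)" for p c
    using that by (auto intro!: Suc.prems(2))
  show ?case
    unfolding carry.simps using Suc.prems(1) by (intro Suc.IH) (auto simp: eq)
qed

lemma carry_add: "carry u j f + carry u j g = carry u j (\<lambda>p c. f p c + g p c)"
proof (induction j arbitrary: f g)
  case (Suc j)
  show ?case
    unfolding carry.simps Suc.IH by (rule arg_cong[of _ _ "carry u j"]) (auto simp: fun_eq_iff algebra_simps)
qed simp

lemma carry_scale: "carry u j (\<lambda>p c. a * f p c) = a * carry u j f"
proof (induction j arbitrary: f)
  case (Suc j)
  show ?case
    unfolding carry.simps Suc.IH[symmetric] by (rule arg_cong[of _ _ "carry u j"]) (auto simp: fun_eq_iff algebra_simps)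
qed simp

lemma path_weight_snoc: "path_weight [] (p @ [c]) = path_weight [] p * (gain p c / (1 - mass p))"
  by (simp add: path_weight_append)

text \<open>Stated for sub-multisets because carrying a letter rearranges prefixes of
  \<open>u\<close>.\<close>

lemma mass_prefix_less_1:
  assumes "u \<in> words n l m" "mset p \<subseteq># mset u" "length p < n"
  shows "mass p < 1"
proof (rule mass_less_1[OF _ _ assms(3)])
  show "set p \<subseteq> {1..l}"
    using set_mset_mono[OF assms(2)] assms(1) by (auto simp: words_def)
  show "count_list p j \<le> m j" if "j \<in> {1..l}" for j
    using mset_subset_eq_count[OF assms(2), of j] assms(1) that by (auto simp: words_def count_mset)
qed

text \<open>
  In the first summand \<open>f\<close> ignores the carried letter. For the last prefix, \<open>j = n - 1\<close>, this is
  harmless since the final letter of a word has conditional probability 1, and the left-hand side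
  becomes the full Tsetlin operator.
\<close>

lemma sum_carry_path_weight:
  assumes u: "u \<in> words n l m" and "j < n"
  shows "weight (u ! 0) * (carry u j (\<lambda>p c. path_weight [] p)
      + (\<Sum>i<j. carry u i (\<lambda>p c. path_weight [] (p @ c # drop (Suc i) (take (Suc j) u)))))
    = path_weight [] (take (Suc j) u)"
  using assms(2)
proof (induction j)
  case 0
  then show ?case
    using u by (simp add: take_Suc_conv_app_nth words_def)
next
  case (Suc j)
  define d U where "d = u ! Suc j" and "U = take (Suc j) u"
  have len: "length u = n" and set: "set u \<subseteq> {1..l}"
    using u by (auto simp: words_def)
  have U': "take (Suc (Suc j)) u = U @ [d]"
    using Suc.prems len by (simp add: take_Suc_conv_app_nth d_def U_def)
  have lenU: "length U = Suc j"
    using Suc.prems len by (simp add: U_def)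
  have subU: "mset U \<subseteq># mset u"
    unfolding U_def by (metis append_take_drop_id mset_append mset_subset_eq_add_left)
  have massU: "mass U < 1"
    using mass_prefix_less_1[OF u subU] Suc.prems lenU by simp
  define \<rho> where "\<rho> = gain U d / (1 - mass U)"
  \<comment> \<open>Here \<open>d\<close> comes after a full rearrangement of \<open>U\<close>, and
    the factor \<open>\<rho>\<close> for reading it depends only on the multiset of
    \<open>U\<close>.\<close>
  have tail: "carry u i (\<lambda>p c. path_weight [] (p @ c # drop (Suc i) (U @ [d])))
      = \<rho> * carry u i (\<lambda>p c. path_weight [] (p @ c # drop (Suc i) U))" if "i < j" for i
    unfolding carry_scale[symmetric]
  proof (rule carry_cong)
    show "i < length u" using that Suc.prems len by simp
    fix p c assume pc: "mset (p @ [c]) = mset (take (Suc i) u)"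
    let ?w = "p @ c # drop (Suc i) U"
    have "take (Suc i) u = take (Suc i) U"
      using that by (simp add: U_def)
    then have "mset ?w = mset U"
      using pc by (intro mset_replace_prefix) simp
    moreover have "p @ c # drop (Suc i) (U @ [d]) = ?w @ [d]"
      using that lenU by simp
    ultimately show "path_weight [] (p @ c # drop (Suc i) (U @ [d])) = \<rho> * path_weight [] ?w"
      unfolding \<rho>_def using path_weight_snoc[of ?w d] mass_cong_mset[of ?w U] gain_cong_mset[of ?w U]
      by (simp only: mult.commute)
  qed
  \<comment> \<open>The summand in which the carried letter moves past \<open>d\<close> combines
    with the new summand \<open>i = j\<close>, in which it stops before \<open>d\<close>; together
    they scale the old head by \<open>\<rho>\<close>.\<close>
  have head: "carry u (Suc j) (\<lambda>p c. path_weight [] p)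
      + carry u j (\<lambda>p c. path_weight [] (p @ c # drop (Suc j) (U @ [d])))
      = \<rho> * carry u j (\<lambda>p c. path_weight [] p)"
    unfolding carry.simps carry_add carry_scale[symmetric] d_def[symmetric]
  proof (rule carry_cong)
    show "j < length u" using Suc.prems len by simp
    fix p c assume pc: "mset (p @ [c]) = mset (take (Suc j) u)"
    let ?W = "path_weight []"
    have pcU: "mset (p @ [c]) = mset U"
      using pc by (simp add: U_def)
    then have "set (p @ [c]) = set U"
      by (metis set_mset_mset)
    moreover have "set U \<subseteq> set u"
      unfolding U_def by (rule set_take_subset)
    ultimately have "c \<in> set u"
      by auto
    then have c: "c \<in> {1..l}"
      using set by blast
    have "mset p \<subseteq># mset u"
      using subU pcU by (metis mset_append mset_subset_eq_add_left subset_mset.order_trans)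
    moreover have "length p < n"
      using arg_cong[OF pcU, of size] lenU Suc.prems by simp
    ultimately have massp: "mass p < 1"
      using mass_prefix_less_1[OF u] by simp
    have mU: "mass U = mass p + gain p c"
      using mass_snoc[OF c, of p] mass_cong_mset[OF pcU] by simp
    have gU: "gain U d = (if d \<le> c then q * gain p d else gain p d + (q - 1) * gain p c)"
      using gain_snoc[of c p d] gain_cong_mset[OF pcU] c by simp
    have \<rho>: "\<rho> * (1 - mass U) = gain U d"
      unfolding \<rho>_def using massU by simp
    have "?W (p @ [c, d]) = ?W p * (gain p c / (1 - mass p)) * \<rho>"
      using path_weight_snoc[of "p @ [c]" d] path_weight_snoc[of p c] mass_cong_mset[OF pcU] gain_cong_mset[OF pcU]
      unfolding \<rho>_def by simp
    \<comment> \<open>By \<open>gain_snoc\<close> the Hecke combination of the gains of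
      \<open>c\<close> and \<open>d\<close> after \<open>p\<close> is
      \<open>gain U d\<close>.\<close>
    then have "(if d \<le> c then q * ?W (p @ [d]) else ?W (p @ [d]) + (q - 1) * ?W (p @ [c])) + ?W (p @ [c, d])
        = ?W p / (1 - mass p) * (gain U d + gain p c * \<rho>)"
      unfolding path_weight_snoc gU by (simp add: algebra_simps add_divide_distrib diff_divide_distrib)
    \<comment> \<open>Both terms contain \<open>\<rho>\<close>: the mass missing after
      \<open>p\<close> is the mass missing after \<open>U\<close> plus the gain of
      \<open>c\<close>.\<close>
    also have "gain U d + gain p c * \<rho> = \<rho> * (1 - mass p)"
      unfolding \<rho>[symmetric] mU by (simp add: algebra_simps)
    finally show "(if d \<le> c then q * ?W (p @ [d]) else ?W (p @ [d]) + (q - 1) * ?W (p @ [c]))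
        + ?W (p @ c # drop (Suc j) (U @ [d])) = \<rho> * ?W p"
      using massp lenU by simp
  qed
  have "carry u (Suc j) (\<lambda>p c. path_weight [] p)
      + (\<Sum>i<Suc j. carry u i (\<lambda>p c. path_weight [] (p @ c # drop (Suc i) (U @ [d]))))
    = (carry u (Suc j) (\<lambda>p c. path_weight [] p)
        + carry u j (\<lambda>p c. path_weight [] (p @ c # drop (Suc j) (U @ [d]))))
      + (\<Sum>i<j. carry u i (\<lambda>p c. path_weight [] (p @ c # drop (Suc i) (U @ [d]))))"
    by (simp only: sum.lessThan_Suc add_ac)
  also have "\<dots> = \<rho> * (carry u j (\<lambda>p c. path_weight [] p)
      + (\<Sum>i<j. carry u i (\<lambda>p c. path_weight [] (p @ c # drop (Suc i) U))))"
    unfolding head using tail by (simp add: distrib_left sum_distrib_left)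
  finally have "weight (u ! 0) * (carry u (Suc j) (\<lambda>p c. path_weight [] p)
      + (\<Sum>i<Suc j. carry u i (\<lambda>p c. path_weight [] (p @ c # drop (Suc i) (U @ [d])))))
    = \<rho> * path_weight [] U"
    using Suc unfolding U_def by (simp only: mult.left_commute)
  also have "\<dots> = path_weight [] (U @ [d])"
    unfolding path_weight_snoc \<rho>_def by simp
  finally show ?case
    unfolding U' .
qed

text \<open>The operator with the largest index acts first, so the induction varies \<open>v\<close>
  and applies the hypothesis to \<open>hecke\<close> of \<open>v\<close>. Swapping unequal
  neighbours changes \<open>inv_word\<close> by one; multiplying by \<open>q ^ inv_word\<close>
  therefore moves the factor \<open>q\<close> from the case \<open>c < d\<close> to the case
  \<open>d < c\<close>.\<close>

lemma hecke_down_carry: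
  assumes u: "u \<in> words n l m" and "j < n"
  shows "q ^ inv_word u * hecke_down (words n l m) q j v u
    = carry u j (\<lambda>p c. q ^ inv_word (p @ c # drop (Suc j) u) * v (p @ c # drop (Suc j) u))"
  using assms(2)
proof (induction j arbitrary: v)
  case 0
  then show ?case
    using u by (cases u) (auto simp: words_def)
next
  case (Suc j)
  let ?W = "words n l m"
  let ?I = "\<lambda>w. q ^ inv_word w"
  define d r where "d = u ! Suc j" and "r = drop (Suc (Suc j)) u"
  have len: "length u = n" using u by (simp add: words_def)
  have dr: "drop (Suc j) u = d # r"
    unfolding d_def r_def using Suc.prems len by (simp add: Cons_nth_drop_Suc)
  have "?I u * hecke_down ?W q (Suc j) v u
      = carry u j (\<lambda>p c. ?I (p @ c # d # r) * hecke ?W q (Suc j) v (p @ c # d # r))"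
    using Suc.IH[of "hecke ?W q (Suc j) v"] Suc.prems by (simp add: dr)
  also have "\<dots> = carry u (Suc j) (\<lambda>p c. ?I (p @ c # r) * v (p @ c # r))"
    unfolding carry.simps d_def[symmetric]
  proof (rule carry_cong)
    show "j < length u" using Suc.prems len by simp
    fix p c assume pc: "mset (p @ [c]) = mset (take (Suc j) u)"
    have "mset (p @ c # d # r) = mset u"
      using mset_replace_prefix[OF pc] unfolding dr .
    then have w: "p @ c # d # r \<in> ?W"
      using u words_cong_mset by blast
    have "length p = j"
      using arg_cong[OF pc, of size] Suc.prems len by simp
    then have H: "hecke ?W q (Suc j) v (p @ c # d # r)
        = (if c \<le> d then q else 1) * v (p @ d # c # r) + (if c < d then q - 1 else 0) * v (p @ c # d # r)"
      using hecke_apply[OF w] by simp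
    consider "c < d" | "c = d" | "d < c" by linarith
    then show "?I (p @ c # d # r) * hecke ?W q (Suc j) v (p @ c # d # r)
        = (if d \<le> c then q * (?I ((p @ [d]) @ c # r) * v ((p @ [d]) @ c # r))
           else ?I ((p @ [d]) @ c # r) * v ((p @ [d]) @ c # r)
             + (q - 1) * (?I ((p @ [c]) @ d # r) * v ((p @ [c]) @ d # r)))"
    proof cases
      case 1
      then show ?thesis
        unfolding H using inv_word_swap[OF 1, of p r] by (simp add: algebra_simps)
    next
      case 2
      then show ?thesis unfolding H by simp
    next
      case 3
      then show ?thesis
        unfolding H using inv_word_swap[OF 3, of p r] by (simp add: algebra_simps)
    qed
  qed
  finally show ?case
    unfolding r_def .
qed

end

section \<open>The factors of \<open>Psi\<close> in terms of mass and gain\<close>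

lemma prod_power_diff: "(\<Prod>k=1..<n. q ^ (n - k)) = (q :: real) ^ (n choose 2)"
proof -
  have "(\<Prod>k=1..<n. q ^ (n - k)) = (\<Prod>k=1..<n. q ^ k)"
    by (rule prod.reindex_bij_witness[of _ "\<lambda>k. n - k" "\<lambda>k. n - k"]) auto
  also have "\<dots> = q ^ (n choose 2)"
  proof (induction n)
    case (Suc n)
    have "Suc n choose 2 = n + (n choose 2)"
      by (simp add: numeral_2_eq_2)
    then show ?case
      using Suc by (cases n) (simp_all add: power_add)
  qed (simp add: binomial_eq_0)
  finally show ?thesis .
qed

text \<open>A position outside \<open>LRM w\<close> has a smaller letter before it. Minimality of
  the first such position gives the last claim, the hypothesis needed for
  \<open>gain_append\<close>.\<close>

lemma first_smaller_props:
  assumes k: "k \<in> {1..length w}" "k \<notin> LRM w"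
  defines "i \<equiv> first_smaller w k"
  shows "1 \<le> i" "i < k" "\<And>a. a \<in> set (take (i - 1) w) \<Longrightarrow> letter w k \<le> a"
proof -
  let ?P = "\<lambda>i. 1 \<le> i \<and> i < k \<and> letter w i < letter w k"
  have "\<exists>i. ?P i"
    using k by (auto simp: LRM_def not_le)
  then have i: "?P i"
    unfolding i_def first_smaller_def by (rule LeastI_ex)
  then show "1 \<le> i" "i < k" by auto
  fix a assume "a \<in> set (take (i - 1) w)"
  then obtain t where t: "a = w ! t" "t < i - 1"
    by (auto simp: in_set_conv_nth)
  have "\<not> ?P (Suc t)"
    using t(2) unfolding i_def first_smaller_def by (intro not_less_Least) auto
  then show "letter w k \<le> a"
    using t i by (auto simp: letter_def)
qed

context tsetlin_parameters
begin

text \<open>Each letter of \<open>t\<close> raises every exponent in \<open>gain p c\<close> by one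
  and adds nothing to the counts of letters below \<open>c\<close>.\<close>

lemma gain_append:
  assumes "\<And>a. a \<in> set t \<Longrightarrow> c \<le> a"
  shows "gain (t @ p) c = q ^ length t * gain p c"
proof -
  have t: "count_list t a = 0 \<and> larger a t = length t" if "a < c" for a
    using assms that by (induction t) fastforce+
  have "larger c t + count_list t c = length t"
    using assms by (induction t) (auto simp: le_less)
  then have "larger c (t @ p) + count_list (t @ p) c = length t + (larger c p + count_list p c)"
    by simp
  then have "q ^ (larger c (t @ p) + count_list (t @ p) c) = q ^ length t * q ^ (larger c p + count_list p c)"
    by (simp only: power_add)
  moreover have "(\<Sum>a=1..<c. (q - 1) * (weight a * q ^ larger a (t @ p) * q_int q (count_list (t @ p) a)))
      = q ^ length t * (\<Sum>a=1..<c. (q - 1) * (weight a * q ^ larger a p * q_int q (count_list p a)))"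
    unfolding sum_distrib_left using t by (intro sum.cong) (auto simp: power_add)
  ultimately show ?thesis
    unfolding gain_def by (simp only: distrib_left mult.left_commute)
qed

lemma gain_minimum: "(\<And>a. a \<in> set t \<Longrightarrow> c \<le> a) \<Longrightarrow> gain t c = weight c * q ^ length t"
  using gain_append[of t c "[]"] by simp

lemma mass_singleton: "c \<in> {1..l} \<Longrightarrow> mass [c] = weight c"
  using mass_snoc[of c "[]"] by simp

text \<open>In a weakly decreasing tuple the last letter is a minimum, so its gain is the single
  term of \<open>gain_minimum\<close>. Appending it lowers the earlier exponents by one, matching
  the change of length in the scaling.\<close>

lemma kappa_decr_eq_mass:
  assumes "set b \<subseteq> {1..l}" "sorted_wrt (\<ge>) b"
  shows "kappa_decr m q x b = q powi (int n - int (length b)) * mass b"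
  using assms
proof (induction b rule: rev_induct)
  case Nil
  then show ?case by (simp add: kappa_decr_def)
next
  case (snoc c b)
  have q0: "q \<noteq> 0" using q_pos by simp
  let ?f = "\<lambda>b i. q powi (int i + int (\<Sum>j=1..letter b i. m j) - int (length b) - 1)
          / q_int q (m (letter b i)) * x (letter b i)"
  let ?k = "length b"
  have c: "c \<in> {1..l}" and cmin: "\<And>a. a \<in> set b \<Longrightarrow> c \<le> a"
    using snoc.prems by (auto simp: sorted_wrt_append)
  have "(\<Sum>i=1..?k. ?f (b @ [c]) i) = (\<Sum>i=1..?k. q powi (- 1) * ?f b i)"
  proof (rule sum.cong)
    fix i assume i: "i \<in> {1..?k}"
    then have l: "letter (b @ [c]) i = letter b i"
      by (auto simp: letter_def nth_append)
    have "q powi (int i + int (\<Sum>j=1..letter b i. m j) - int (length (b @ [c])) - 1)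
        = q powi (- 1) * q powi (int i + int (\<Sum>j=1..letter b i. m j) - int (length b) - 1)"
      using q0 by (subst power_int_add[symmetric]) (simp_all add: algebra_simps)
    then show "?f (b @ [c]) i = q powi (- 1) * ?f b i"
      unfolding l by simp
  qed simp
  then have 1: "(\<Sum>i=1..?k. ?f (b @ [c]) i) = q powi (int n - int (Suc ?k)) * mass b"
  proof -
    have "q powi (int n - int (Suc ?k)) = q powi (- 1) * q powi (int n - int ?k)"
      using q0 by (subst power_int_add[symmetric]) (simp_all add: algebra_simps)
    then show ?thesis
      using \<open>(\<Sum>i=1..?k. ?f (b @ [c]) i) = (\<Sum>i=1..?k. q powi (- 1) * ?f b i)\<close> snoc
      unfolding sum_distrib_left[symmetric] kappa_decr_def by (simp add: sorted_wrt_append)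
  qed
  have "?f (b @ [c]) (Suc ?k) = q powi (int n - int (Suc ?k)) * gain b c"
  proof -
    have l: "letter (b @ [c]) (Suc ?k) = c"
      by (simp add: letter_def)
    have "(\<Sum>j=1..l. m j) = (\<Sum>j=1..c. m j) + (\<Sum>j=Suc c..l. m j)"
      using c sum.ub_add_nat[of 1 c m "l - c"] by simp
    \<comment> \<open>Replacing the initial sum of \<open>m\<close> by \<open>n\<close> minus its
      tail produces the power of \<open>q\<close> in the denominator of
      \<open>weight c\<close>.\<close>
    then have "int (\<Sum>j=1..c. m j) - 1 + int (\<Sum>j=Suc c..l. m j) = int n - int (Suc ?k) + int ?k"
      using sum_m by linarith
    then have "q powi (int (\<Sum>j=1..c. m j) - 1) * q ^ (\<Sum>j=Suc c..l. m j)
        = q powi (int n - int (Suc ?k)) * q ^ ?k"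
      using q0 by (metis power_int_add power_int_of_nat)
    then have "q powi (int (\<Sum>j=1..c. m j) - 1)
        = q powi (int n - int (Suc ?k)) * q ^ ?k / q ^ (\<Sum>j=Suc c..l. m j)"
      using q0 by (simp add: field_simps)
    moreover have "int (Suc ?k) + int (\<Sum>j=1..c. m j) - int (length (b @ [c])) - 1
        = int (\<Sum>j=1..c. m j) - 1"
      by simp
    moreover have "gain b c = weight c * q ^ ?k"
      by (rule gain_minimum[OF cmin])
    ultimately show ?thesis
      unfolding l weight_def by (simp only:) (simp add: mult_ac)
  qed
  then have "kappa_decr m q x (b @ [c]) = q powi (int n - int (Suc ?k)) * (mass b + gain b c)"
    unfolding kappa_decr_def distrib_left 1[symmetric] by simp
  then show ?case
    unfolding mass_snoc[OF c] by simp
qed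

lemma kappa_eq_mass:
  assumes "set p \<subseteq> {1..l}"
  shows "kappa m q x p = q powi (int n - int (length p)) * mass p"
proof -
  have "sorted_wrt (\<ge>) (rev (sort p))"
    unfolding sorted_wrt_rev by simp
  then show ?thesis
    unfolding kappa_def using kappa_decr_eq_mass[of "rev (sort p)"] assms mass_cong_mset[of "rev (sort p)" p]
    by simp
qed

text \<open>The power of \<open>q\<close> in \<open>denom_factor\<close> is inverse to the scaling
  between \<open>kappa\<close> and \<open>mass\<close> for length \<open>k - 1\<close>.\<close>

lemma denom_factor_eq:
  assumes w: "w \<in> words n l m" and k: "k \<in> {1..n}"
  shows "denom_factor n l m q x w k = 1 - mass (take (k - 1) w)"
proof -
  have len: "length w = n" and set: "set w \<subseteq> {1..l}"
    using w by (auto simp: words_def)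
  have p: "subword w 1 (k - 1) = take (k - 1) w"
    using k len by (subst subword_eq) auto
  have "kappa m q x (take (k - 1) w) = q powi (int n - int (k - 1)) * mass (take (k - 1) w)"
    using kappa_eq_mass[of "take (k - 1) w"] set set_take_subset[of "k - 1" w] k len by auto
  moreover have "q powi (int k - int n - 1) * q powi (int n - int (k - 1)) = 1"
    using q_pos k by (subst power_int_add[symmetric]) auto
  ultimately show ?thesis
    unfolding denom_factor_def p sum_x by (simp only: mult.assoc[symmetric] mult_1_left)
qed

lemma kappa_LRM_eq:
  assumes w: "w \<in> words n l m" and k: "k \<in> {1..n}" "k \<in> LRM w"
  shows "kappa m q x [letter w k] = q ^ (n - k) * gain (take (k - 1) w) (letter w k)"
proof -
  have len: "length w = n" and set: "set w \<subseteq> {1..l}"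
    using w by (auto simp: words_def)
  have c: "letter w k \<in> {1..l}"
    by (rule letter_in_alphabet[OF w k(1)])
  have lk: "length (take (k - 1) w) = k - 1"
    using k len by auto
  have "letter w k \<le> a" if "a \<in> set (take (k - 1) w)" for a
  proof -
    obtain t where "a = w ! t" "t < k - 1"
      using \<open>a \<in> set (take (k - 1) w)\<close> by (auto simp: in_set_conv_nth)
    moreover have "Suc t \<in> {1..<k}"
      using \<open>t < k - 1\<close> by auto
    ultimately show ?thesis
      using k(2) unfolding LRM_def letter_def by fastforce
  qed
  then have "gain (take (k - 1) w) (letter w k) = weight (letter w k) * q ^ (k - 1)"
    using gain_minimum[of "take (k - 1) w" "letter w k"] lk by simp
  moreover have "kappa m q x [letter w k] = q powi (int n - 1) * weight (letter w k)"
    using kappa_eq_mass[of "[letter w k]"] c mass_singleton[OF c] by simp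
  moreover have "int n - 1 = int ((n - k) + (k - 1))"
    using k by auto
  then have "q powi (int n - 1) = q ^ (n - k) * q ^ (k - 1)"
    by (simp only: power_int_of_nat power_add)
  ultimately show ?thesis by simp
qed

text \<open>The factor \<open>q powi (-1)\<close> brings both values of \<open>kappa\<close> to the
  same scale, so their difference is the gain of the last letter over the segment starting at
  \<open>first_smaller w k\<close>.\<close>

lemma ascent_factor_eq:
  assumes w: "w \<in> words n l m" and k: "k \<in> {1..n}" "k \<notin> LRM w"
  shows "ascent_factor m q x w k = q ^ (n - k) * gain (take (k - 1) w) (letter w k)"
proof -
  have len: "length w = n" and set: "set w \<subseteq> {1..l}"
    using w by (auto simp: words_def)
  have q0: "q \<noteq> 0" using q_pos by simp
  define c i p where "c = letter w k" and "i = first_smaller w k" and "p = drop (i - 1) (take (k - 1) w)"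
  have c: "c \<in> {1..l}"
    unfolding c_def by (rule letter_in_alphabet[OF w k(1)])
  have i: "1 \<le> i" "i < k" and min: "\<And>a. a \<in> set (take (i - 1) w) \<Longrightarrow> c \<le> a"
    using first_smaller_props[of k w] k len unfolding i_def c_def by auto
  have "k - 1 < length w" "Suc (k - 1) = k"
    using k len by auto
  then have "take k w = take (k - 1) w @ [c]"
    using take_Suc_conv_app_nth[of "k - 1" w] by (simp add: c_def letter_def)
  then have pc: "subword w i k = p @ [c]"
    using i k len by (subst subword_eq) (auto simp: p_def)
  have p: "subword w i (k - 1) = p"
    using i k len by (subst subword_eq) (auto simp: p_def)
  have setp: "set p \<subseteq> {1..l}"
    using set unfolding p_def by (meson in_set_dropD in_set_takeD subset_eq)
  have lenp: "length p = k - i"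
    using i k len by (simp add: p_def)
  have split: "take (k - 1) w = take (i - 1) w @ p"
  proof -
    have "take (i - 1) w = take (i - 1) (take (k - 1) w)"
      using i by simp
    then show ?thesis unfolding p_def by (simp only: append_take_drop_id)
  qed
  let ?e = "int n - int (Suc (length p))"
  have "kappa m q x (p @ [c]) = q powi ?e * mass (p @ [c])"
    using kappa_eq_mass[of "p @ [c]"] setp c by simp
  moreover have "q powi (-1) * kappa m q x p = q powi ?e * mass p"
  proof -
    have "q powi (-1) * q powi (int n - int (length p)) = q powi ?e"
      using q0 by (subst power_int_add[symmetric]) (simp_all add: algebra_simps)
    then show ?thesis
      unfolding kappa_eq_mass[OF setp] by (simp only: mult.assoc[symmetric])
  qed
  ultimately have "ascent_factor m q x w k = q powi ?e * gain p c"
    unfolding ascent_factor_def i_def[symmetric] pc p mass_snoc[OF c] by (simp add: algebra_simps)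
  \<comment> \<open>The exponent splits into \<open>n - k\<close> and the \<open>i - 1\<close>
    letters before the segment, which \<open>gain_append\<close> puts back since none is below
    \<open>c\<close>.\<close>
  also have "?e = int ((n - k) + (i - 1))"
    using i k lenp by auto
  also have "q powi \<dots> * gain p c = q ^ (n - k) * gain (take (i - 1) w @ p) c"
    using gain_append[of "take (i - 1) w" c p, OF min] i k len by (simp only: power_int_of_nat power_add) simp
  finally show ?thesis
    unfolding split c_def .
qed

lemma path_weight_eq_prod:
  "path_weight [] w = (\<Prod>k<length w. gain (take k w) (w ! k) / (1 - mass (take k w)))"
proof (induction w rule: rev_induct)
  case (snoc c w)
  have "(\<Prod>k<length w. gain (take k (w @ [c])) ((w @ [c]) ! k) / (1 - mass (take k (w @ [c]))))
      = (\<Prod>k<length w. gain (take k w) (w ! k) / (1 - mass (take k w)))"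
    by (rule prod.cong) (auto simp: nth_append)
  then show ?case
    unfolding path_weight_snoc snoc by simp
qed simp

lemma n_pos: "n > 0"
proof -
  have "{1..l} \<noteq> {}"
    using sum_x by force
  then show ?thesis
    using m_pos sum_m by (metis all_not_in_conv finite_atLeastAtMost not_gr0 sum_eq_0_iff)
qed

text \<open>The last letter gains all the missing mass. This reconciles the products in
  \<open>Psi\<close>, which stop at \<open>n - 1\<close>, with the path weight of the full
  word.\<close>

lemma path_weight_word:
  assumes "p @ [c] \<in> words n l m"
  shows "path_weight [] (p @ [c]) = path_weight [] p"
proof -
  have c: "c \<in> {1..l}" using assms by (auto simp: words_def)
  have "gain p c = 1 - mass p"
    using mass_snoc[OF c, of p] mass_word[OF assms] by simp
  moreover have "gain p c > 0"
    by (rule gain_pos[OF c])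
  ultimately show ?thesis
    unfolding path_weight_snoc by simp
qed

text \<open>Both kinds of position contribute \<open>q ^ (n - k)\<close> times a gain, so the two
  numerator products merge and the powers multiply to \<open>q ^ (n choose 2)\<close>.\<close>

lemma Psi_eq:
  assumes w: "w \<in> words n l m"
  shows "Psi n l m q x w = q powi (- int (inv_word w))
    * (q ^ (n choose 2) * (\<Prod>i=1..l. norm_factor q (m i)) * path_weight [] w)"
proof -
  have len: "length w = n"
    using w by (auto simp: words_def)
  let ?A = "{1..n-1}" and ?g = "\<lambda>k. gain (take (k - 1) w) (letter w k)"
  have A: "?A = {1..<n}"
    using n_pos by auto
  have "(\<Prod>k\<in>?A \<inter> LRM w. kappa m q x [letter w k]) * (\<Prod>k\<in>?A - LRM w. ascent_factor m q x w k)
      = (\<Prod>k\<in>?A \<inter> LRM w. q ^ (n - k) * ?g k) * (\<Prod>k\<in>?A - LRM w. q ^ (n - k) * ?g k)"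
    by (intro arg_cong2[of _ _ _ _ "(*)"] prod.cong kappa_LRM_eq[OF w] ascent_factor_eq[OF w]) auto
  also have "\<dots> = (\<Prod>k\<in>?A. q ^ (n - k) * ?g k)"
    by (rule prod.Int_Diff[symmetric]) simp
  also have "\<dots> = q ^ (n choose 2) * (\<Prod>k\<in>?A. ?g k)"
    unfolding prod.distrib A prod_power_diff ..
  finally have num: "(\<Prod>k\<in>?A \<inter> LRM w. kappa m q x [letter w k]) * (\<Prod>k\<in>?A - LRM w. ascent_factor m q x w k)
      = q ^ (n choose 2) * (\<Prod>k\<in>?A. ?g k)" .
  have den: "(\<Prod>k\<in>?A. denom_factor n l m q x w k) = (\<Prod>k\<in>?A. 1 - mass (take (k - 1) w))"
    using w by (intro prod.cong denom_factor_eq) auto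
  let ?p = "take (n - 1) w"
  have "w = ?p @ [w ! (n - 1)]"
    using take_Suc_conv_app_nth[of "n - 1" w] len n_pos by simp
  then have "path_weight [] w = path_weight [] ?p"
    using path_weight_word w by metis
  also have "\<dots> = (\<Prod>k<n-1. gain (take k ?p) (?p ! k) / (1 - mass (take k ?p)))"
    unfolding path_weight_eq_prod using len by simp
  also have "\<dots> = (\<Prod>k\<in>?A. ?g k / (1 - mass (take (k - 1) w)))"
    by (rule prod.reindex_bij_witness[of _ "\<lambda>k. k - 1" Suc]) (auto simp: letter_def)
  finally have "path_weight [] w = (\<Prod>k\<in>?A. ?g k) / (\<Prod>k\<in>?A. 1 - mass (take (k - 1) w))"
    by (simp only: prod_dividef)
  then show ?thesis
    unfolding Psi_def num den by simp
qed

section \<open>Stationarity, normalisation and positivity\<close>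

lemma tsetlin_apply:
  assumes u: "u \<in> words n l m"
  shows "tsetlin n l m q x v u = weight (u ! 0) * (\<Sum>i<n. hecke_down (words n l m) q i v u)"
proof -
  have "extend (words n l m) (X_word l m q x) f u = weight (u ! 0) * f u" for f
  proof -
    have "extend (words n l m) (X_word l m q x) f u
        = (\<Sum>w\<in>words n l m. if w = u then weight (u ! 0) * f u else 0)"
      unfolding extend_def
      by (rule sum.cong) (auto simp: X_word_def basis_vec_def weight_def letter_def)
    then show ?thesis
      using u by (simp add: sum.delta finite_words)
  qed
  then have "tsetlin n l m q x v u = (\<Sum>i=1..n. weight (u ! 0) * hecke_down (words n l m) q (i - 1) v u)"
    unfolding tsetlin_def by simp
  also have "\<dots> = (\<Sum>i<n. weight (u ! 0) * hecke_down (words n l m) q i v u)"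
    by (rule sum.reindex_bij_witness[of _ Suc "\<lambda>i. i - 1"]) auto
  finally show ?thesis
    by (simp only: sum_distrib_left)
qed

text \<open>After multiplication by \<open>q ^ inv_word u\<close>, the sum consists of carries of
  path weights, and \<open>sum_carry_path_weight\<close> applies with
  \<open>j = n - 1\<close>.\<close>

lemma tsetlin_Psi:
  assumes u: "u \<in> words n l m"
  shows "tsetlin n l m q x (Psi n l m q x) u = Psi n l m q x u"
proof -
  define K where "K = q ^ (n choose 2) * (\<Prod>i=1..l. norm_factor q (m i))"
  define j where "j = n - 1"
  have n: "n = Suc j" using n_pos by (simp add: j_def)
  have len: "length u = n" using u by (simp add: words_def)
  let ?W = "path_weight []" and ?I = "q ^ inv_word u"
  have q0: "q \<noteq> 0" using q_pos by simp
  have Psi: "q ^ inv_word w * Psi n l m q x w = K * ?W w" if "w \<in> words n l m" for w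
    unfolding Psi_eq[OF that] K_def using q0 by (simp add: power_int_minus)
  have down: "?I * hecke_down (words n l m) q i (Psi n l m q x) u
      = K * carry u i (\<lambda>p c. ?W (p @ c # drop (Suc i) u))" if "i < n" for i
    unfolding hecke_down_carry[OF u that] carry_scale[symmetric]
  proof (rule carry_cong)
    show "i < length u" using that len by simp
    fix p c assume pc: "mset (p @ [c]) = mset (take (Suc i) u)"
    have "p @ c # drop (Suc i) u \<in> words n l m"
      using u words_cong_mset[OF mset_replace_prefix[OF pc]] by blast
    then show "q ^ inv_word (p @ c # drop (Suc i) u) * Psi n l m q x (p @ c # drop (Suc i) u)
        = K * ?W (p @ c # drop (Suc i) u)"
      by (rule Psi)
  qed
  \<comment> \<open>At \<open>j = n - 1\<close> the carried letter ends the word and contributes the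
    factor 1, giving the summand that ignores it.\<close>
  have last: "carry u j (\<lambda>p c. ?W (p @ c # drop (Suc j) u)) = carry u j (\<lambda>p c. ?W p)"
  proof (rule carry_cong)
    show "j < length u" using n len by simp
    fix p c assume pc: "mset (p @ [c]) = mset (take (Suc j) u)"
    then have "p @ [c] \<in> words n l m"
      using u words_cong_mset[of "p @ [c]" u] n len by simp
    then show "?W (p @ c # drop (Suc j) u) = ?W p"
      using path_weight_word n len by simp
  qed
  have "?I * tsetlin n l m q x (Psi n l m q x) u
      = weight (u ! 0) * (\<Sum>i<n. ?I * hecke_down (words n l m) q i (Psi n l m q x) u)"
    unfolding tsetlin_apply[OF u] by (simp add: sum_distrib_left mult_ac)
  also have "\<dots> = K * (weight (u ! 0) * (\<Sum>i<n. carry u i (\<lambda>p c. ?W (p @ c # drop (Suc i) u))))"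
    using down by (simp add: sum_distrib_left mult_ac)
  also have "(\<Sum>i<n. carry u i (\<lambda>p c. ?W (p @ c # drop (Suc i) u)))
      = carry u j (\<lambda>p c. ?W p) + (\<Sum>i<j. carry u i (\<lambda>p c. ?W (p @ c # drop (Suc i) (take (Suc j) u))))"
    unfolding n sum.lessThan_Suc last using n len by simp
  also have "weight (u ! 0) * \<dots> = ?W u"
    using sum_carry_path_weight[OF u, of j] n len by simp
  also have "K * ?W u = ?I * Psi n l m q x u"
    by (rule Psi[OF u, symmetric])
  finally show ?thesis
    using q0 by simp
qed

lemma sum_Psi: "(\<Sum>w\<in>words n l m. Psi n l m q x w) = 1"
proof -
  let ?P = "\<Prod>i=1..l. norm_factor q (m i)"
  have "?P > 0"
    by (intro prod_pos) (simp add: norm_factor_pos q_pos)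
  have "(\<Sum>w\<in>words n l m. Psi n l m q x w)
      = (\<Sum>w\<in>words n l m. q ^ (n choose 2) * ?P * (q powi (- int (inv_word w)) * path_weight [] w))"
    by (rule sum.cong) (auto simp: Psi_eq)
  also have "\<dots> = q ^ (n choose 2) * ?P * (q powi (- int (n choose 2)) / ?P)"
    unfolding sum_distrib_left[symmetric] using sum_path_weight[of "[]" m n] sum_m by simp
  also have "\<dots> = 1"
    using less_imp_neq[OF \<open>?P > 0\<close>] q_pos by (simp add: power_int_minus del: prod_zero_iff)
  finally show ?thesis .
qed

lemma factors_pos:
  assumes w: "w \<in> words n l m"
  shows "\<And>k. k \<in> {1..n-1} \<Longrightarrow> denom_factor n l m q x w k > 0"
    and "\<And>k. k \<in> {1..n-1} \<inter> LRM w \<Longrightarrow> kappa m q x [letter w k] > 0"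
    and "\<And>k. k \<in> {1..n-1} - LRM w \<Longrightarrow> ascent_factor m q x w k > 0"
proof -
  have len: "length w = n" and set: "set w \<subseteq> {1..l}"
    using w by (auto simp: words_def)
  have c: "letter w k \<in> {1..l}" if "k \<in> {1..n-1}" for k
    using that by (intro letter_in_alphabet[OF w]) auto
  show "denom_factor n l m q x w k > 0" if "k \<in> {1..n-1}" for k
  proof -
    have "mset (take (k - 1) w) \<subseteq># mset w"
      by (metis append_take_drop_id mset_append mset_subset_eq_add_left)
    then show ?thesis
      using that denom_factor_eq[OF w, of k] mass_prefix_less_1[OF w, of "take (k - 1) w"] len by auto
  qed
  show "kappa m q x [letter w k] > 0" if "k \<in> {1..n-1} \<inter> LRM w" for k
    using that kappa_LRM_eq[OF w, of k] gain_pos[OF c, of k] q_pos by auto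
  show "ascent_factor m q x w k > 0" if "k \<in> {1..n-1} - LRM w" for k
    using that ascent_factor_eq[OF w, of k] gain_pos[OF c, of k] q_pos by auto
qed

end

theorem theorem2p11:
  fixes n l :: nat and m :: "nat \<Rightarrow> nat" and q :: real and x :: "nat \<Rightarrow> real"
  assumes "q \<ge> 1"
    and "\<And>j. j \<in> {1..l} \<Longrightarrow> m j > 0"
    and "(\<Sum>j=1..l. m j) = n"
    and "\<And>j. j \<in> {1..l} \<Longrightarrow> x j > 0"
    and "(\<Sum>j=1..l. x j) = 1"
  shows "(\<forall>w\<in>words n l m.
            tsetlin n l m q x (Psi n l m q x) w = (\<Sum>i=1..l. x i) * Psi n l m q x w)
    \<and> (\<forall>w\<in>words n l m.
          q powi (- int (inv_word w)) > 0
        \<and> (\<forall>i\<in>{1..l}. norm_factor q (m i) > 0)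
        \<and> (\<forall>k\<in>{1..n-1}. denom_factor n l m q x w k > 0)
        \<and> (\<forall>k\<in>{1..n-1} \<inter> LRM w. kappa m q x [letter w k] > 0)
        \<and> (\<forall>k\<in>{1..n-1} - LRM w. ascent_factor m q x w k > 0))
    \<and> (\<Sum>w\<in>words n l m. Psi n l m q x w) = 1"
proof -
  interpret tsetlin_parameters n l m q x
    by unfold_locales (use assms in auto)
  show ?thesis
    using tsetlin_Psi factors_pos sum_Psi norm_factor_pos[OF q_pos] q_pos
    unfolding sum_x by (simp add: del: One_nat_def)
qed

end
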